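(* Let $A$ be a commutative unital ring, $k\subseteq A$ a fixed subring, and $E$ a finitely generated projective left $A$-module with a projective basis $B=\{e_1,\dots,e_n\}\subseteq E$, $B^*=\{x_1,\dots,x_n\}\subseteq E^*$. Let $\nabla:\operatorname{Der}_k(A)\to\operatorname{End}_k(E)$ be the connection $\nabla(\delta)(e)=\sum_{i=1}^n\delta(x_i(e))e_i$, and let $M=(x_i(e_j))_{1\le i,j\le n}$ be the fundamental matrix. Then for all $\delta,\eta\in\operatorname{Der}_k(A)$ \[R_\nabla(\delta,\eta)=\big[[\delta(M)]_B,[\eta(M)]_B\big],\] that is, if $e=\sum_j a_je_j\in E$ with $a_1,\dots,a_n\in A$ and $a=(a_1,\dots,a_n)^T$, then \[R_\nabla(\delta,\eta)(e)=\sum_{i=1}^n\Big(\big(\delta(M)\eta(M)-\eta(M)\delta(M)\big)a\Big)_i\,e_i .\]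
   Context: Projective basis: finite families $e_1,\dots,e_n\in E$ and $x_1,\dots,x_n\in E^*=\operatorname{Hom}_A(E,A)$ with $\sum_j x_j(e)e_j=e$ for all $e\in E$. For a derivation $\delta$, $\delta(M)$ is the $n\times n$ matrix over $A$ obtained by applying $\delta$ to each entry of $M$, i.e. $\delta(M)_{ij}=\delta(x_i(e_j))$. For an $n\times n$ matrix $N$ over $A$, the notation $[N]_B$ indicates that $N$ acts on the coordinate column $a=(a_1,\dots,a_n)^T$ of an element $e=\sum_j a_je_j$, the result being read as the coordinate column, with respect to $e_1,\dots,e_n$, of an element of $E$. The curvature of $\nabla$ is $R_\nabla(\delta,\eta)=[\nabla(\delta),\nabla(\eta)]-\nabla([\delta,\eta])=\nabla(\delta)\circ\nabla(\eta)-\nabla(\eta)\circ\nabla(\delta)-\nabla([\delta,\eta])$. *)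

theory Defs
  imports "HOL-Algebra.Module" "HOL-Algebra.Subrings"
begin

text \<open>
  As usual in HOL-Algebra, maps between structures are only constrained on carriers, and rings
  need not satisfy \<open>\<one> \<noteq> \<zero>\<close>. The argument \<open>A\<close> is the commutative base ring, \<open>E\<close> the module.
\<close>

section \<open>Linear maps and projective bases\<close>

definition mod_hom ::
  "('a, 'r) ring_scheme \<Rightarrow> ('a, 'b, 'm) module_scheme \<Rightarrow> ('a, 'c, 'n) module_scheme \<Rightarrow> ('b \<Rightarrow> 'c) set"
  where
  "mod_hom A E F = {f \<in> carrier E \<rightarrow> carrier F.
     (\<forall>u\<in>carrier E. \<forall>v\<in>carrier E. f (u \<oplus>\<^bsub>E\<^esub> v) = f u \<oplus>\<^bsub>F\<^esub> f v) \<and>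
     (\<forall>c\<in>carrier A. \<forall>v\<in>carrier E. f (c \<odot>\<^bsub>E\<^esub> v) = c \<odot>\<^bsub>F\<^esub> f v)}"

definition dual_mod :: "('a, 'r) ring_scheme \<Rightarrow> ('a, 'b, 'm) module_scheme \<Rightarrow> ('b \<Rightarrow> 'a) set" where
  "dual_mod A E = {f \<in> carrier E \<rightarrow> carrier A.
     (\<forall>u\<in>carrier E. \<forall>v\<in>carrier E. f (u \<oplus>\<^bsub>E\<^esub> v) = f u \<oplus>\<^bsub>A\<^esub> f v) \<and>
     (\<forall>c\<in>carrier A. \<forall>v\<in>carrier E. f (c \<odot>\<^bsub>E\<^esub> v) = c \<otimes>\<^bsub>A\<^esub> f v)}"

text \<open>The \<open>K\<close>-linear endomorphisms, for \<open>K\<close> a subring of the base ring.\<close>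

definition End_mod :: "'a set \<Rightarrow> ('a, 'b, 'm) module_scheme \<Rightarrow> ('b \<Rightarrow> 'b) set" where
  "End_mod K E = {f \<in> carrier E \<rightarrow> carrier E.
     (\<forall>u\<in>carrier E. \<forall>v\<in>carrier E. f (u \<oplus>\<^bsub>E\<^esub> v) = f u \<oplus>\<^bsub>E\<^esub> f v) \<and>
     (\<forall>c\<in>K. \<forall>v\<in>carrier E. f (c \<odot>\<^bsub>E\<^esub> v) = c \<odot>\<^bsub>E\<^esub> f v)}"

text \<open>
  Families, vectors and matrices are functions of indices in \<open>{1..n}\<close>. A module with a projective
  basis is finitely generated and projective; see \<open>projective_basis_imp_fg\<close> and
  \<open>projective_basis_imp_projective\<close> below.
\<close>

definition projective_basis ::
  "('a, 'r) ring_scheme \<Rightarrow> ('a, 'b, 'm) module_scheme \<Rightarrow> nat \<Rightarrow> (nat \<Rightarrow> 'b) \<Rightarrow> (nat \<Rightarrow> 'b \<Rightarrow> 'a) \<Rightarrow> bool"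
  where
  "projective_basis A E n e x \<longleftrightarrow>
     e \<in> {1..n} \<rightarrow> carrier E \<and> x \<in> {1..n} \<rightarrow> dual_mod A E \<and>
     (\<forall>v\<in>carrier E. (\<Oplus>\<^bsub>E\<^esub>j\<in>{1..n}. x j v \<odot>\<^bsub>E\<^esub> e j) = v)"

section \<open>Derivations, connection and curvature\<close>

definition Der :: "'a set \<Rightarrow> ('a, 'r) ring_scheme \<Rightarrow> ('a \<Rightarrow> 'a) set" where
  "Der K A = {d \<in> carrier A \<rightarrow> carrier A.
     (\<forall>a\<in>carrier A. \<forall>b\<in>carrier A. d (a \<oplus>\<^bsub>A\<^esub> b) = d a \<oplus>\<^bsub>A\<^esub> d b) \<and>
     (\<forall>c\<in>K. \<forall>a\<in>carrier A. d (c \<otimes>\<^bsub>A\<^esub> a) = c \<otimes>\<^bsub>A\<^esub> d a) \<and>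
     (\<forall>a\<in>carrier A. \<forall>b\<in>carrier A. d (a \<otimes>\<^bsub>A\<^esub> b) = d a \<otimes>\<^bsub>A\<^esub> b \<oplus>\<^bsub>A\<^esub> a \<otimes>\<^bsub>A\<^esub> d b)}"

definition der_bracket :: "('a, 'r) ring_scheme \<Rightarrow> ('a \<Rightarrow> 'a) \<Rightarrow> ('a \<Rightarrow> 'a) \<Rightarrow> 'a \<Rightarrow> 'a" where
  "der_bracket A \<delta> \<eta> = (\<lambda>a. \<delta> (\<eta> a) \<ominus>\<^bsub>A\<^esub> \<eta> (\<delta> a))"

definition basis_connection ::
  "('a, 'b, 'm) module_scheme \<Rightarrow> nat \<Rightarrow> (nat \<Rightarrow> 'b) \<Rightarrow> (nat \<Rightarrow> 'b \<Rightarrow> 'a) \<Rightarrow> ('a \<Rightarrow> 'a) \<Rightarrow> 'b \<Rightarrow> 'b"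
  where
  "basis_connection E n e x \<delta> v = (\<Oplus>\<^bsub>E\<^esub>i\<in>{1..n}. \<delta> (x i v) \<odot>\<^bsub>E\<^esub> e i)"

definition curvature ::
  "('a, 'r) ring_scheme \<Rightarrow> ('a, 'b, 'm) module_scheme \<Rightarrow> (('a \<Rightarrow> 'a) \<Rightarrow> 'b \<Rightarrow> 'b) \<Rightarrow>
    ('a \<Rightarrow> 'a) \<Rightarrow> ('a \<Rightarrow> 'a) \<Rightarrow> 'b \<Rightarrow> 'b" where
  "curvature A E D \<delta> \<eta> v =
     (D \<delta> (D \<eta> v) \<ominus>\<^bsub>E\<^esub> D \<eta> (D \<delta> v)) \<ominus>\<^bsub>E\<^esub> D (der_bracket A \<delta> \<eta>) v"

section \<open>Matrices\<close>

definition fund_matrix :: "(nat \<Rightarrow> 'b) \<Rightarrow> (nat \<Rightarrow> 'b \<Rightarrow> 'a) \<Rightarrow> nat \<Rightarrow> nat \<Rightarrow> 'a" where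
  "fund_matrix e x = (\<lambda>i j. x i (e j))"

definition mat_apply :: "('a \<Rightarrow> 'a) \<Rightarrow> (nat \<Rightarrow> nat \<Rightarrow> 'a) \<Rightarrow> nat \<Rightarrow> nat \<Rightarrow> 'a" where
  "mat_apply \<delta> N = (\<lambda>i j. \<delta> (N i j))"

definition mat_mult ::
  "('a, 'r) ring_scheme \<Rightarrow> nat \<Rightarrow> (nat \<Rightarrow> nat \<Rightarrow> 'a) \<Rightarrow> (nat \<Rightarrow> nat \<Rightarrow> 'a) \<Rightarrow> nat \<Rightarrow> nat \<Rightarrow> 'a" where
  "mat_mult A n N P = (\<lambda>i j. \<Oplus>\<^bsub>A\<^esub>l\<in>{1..n}. N i l \<otimes>\<^bsub>A\<^esub> P l j)"

definition mat_commutator ::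
  "('a, 'r) ring_scheme \<Rightarrow> nat \<Rightarrow> (nat \<Rightarrow> nat \<Rightarrow> 'a) \<Rightarrow> (nat \<Rightarrow> nat \<Rightarrow> 'a) \<Rightarrow> nat \<Rightarrow> nat \<Rightarrow> 'a" where
  "mat_commutator A n N P = (\<lambda>i j. mat_mult A n N P i j \<ominus>\<^bsub>A\<^esub> mat_mult A n P N i j)"

definition mat_vec ::
  "('a, 'r) ring_scheme \<Rightarrow> nat \<Rightarrow> (nat \<Rightarrow> nat \<Rightarrow> 'a) \<Rightarrow> (nat \<Rightarrow> 'a) \<Rightarrow> nat \<Rightarrow> 'a" where
  "mat_vec A n N a = (\<lambda>i. \<Oplus>\<^bsub>A\<^esub>j\<in>{1..n}. N i j \<otimes>\<^bsub>A\<^esub> a j)"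

text \<open>
  The element of \<open>E\<close> with coordinate column \<open>a\<close>. Coordinates are not unique, so the action of a
  matrix on columns does not in general descend to \<open>E\<close>; this is why \<open>[N]\<^sub>B\<close> is represented by
  \<open>lin_comb E n e (mat_vec A n N a)\<close>, a function of the column \<open>a\<close> and not of \<open>lin_comb E n e a\<close>,
  and why commutators are formed at the level of columns.
\<close>

definition lin_comb :: "('a, 'b, 'm) module_scheme \<Rightarrow> nat \<Rightarrow> (nat \<Rightarrow> 'b) \<Rightarrow> (nat \<Rightarrow> 'a) \<Rightarrow> 'b" where
  "lin_comb E n e a = (\<Oplus>\<^bsub>E\<^esub>i\<in>{1..n}. a i \<odot>\<^bsub>E\<^esub> e i)"

section \<open>Well-definedness\<close>

lemma dual_modD:
  assumes "f \<in> dual_mod A E"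
  shows "v \<in> carrier E \<Longrightarrow> f v \<in> carrier A"
    and "u \<in> carrier E \<Longrightarrow> v \<in> carrier E \<Longrightarrow> f (u \<oplus>\<^bsub>E\<^esub> v) = f u \<oplus>\<^bsub>A\<^esub> f v"
    and "c \<in> carrier A \<Longrightarrow> v \<in> carrier E \<Longrightarrow> f (c \<odot>\<^bsub>E\<^esub> v) = c \<otimes>\<^bsub>A\<^esub> f v"
  using assms unfolding dual_mod_def by auto

lemma DerD:
  assumes "d \<in> Der K A"
  shows "a \<in> carrier A \<Longrightarrow> d a \<in> carrier A"
    and "a \<in> carrier A \<Longrightarrow> b \<in> carrier A \<Longrightarrow> d (a \<oplus>\<^bsub>A\<^esub> b) = d a \<oplus>\<^bsub>A\<^esub> d b"
    and "c \<in> K \<Longrightarrow> a \<in> carrier A \<Longrightarrow> d (c \<otimes>\<^bsub>A\<^esub> a) = c \<otimes>\<^bsub>A\<^esub> d a"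
    and "a \<in> carrier A \<Longrightarrow> b \<in> carrier A \<Longrightarrow>
           d (a \<otimes>\<^bsub>A\<^esub> b) = d a \<otimes>\<^bsub>A\<^esub> b \<oplus>\<^bsub>A\<^esub> a \<otimes>\<^bsub>A\<^esub> d b"
  using assms unfolding Der_def by auto

lemma projective_basisD:
  assumes "projective_basis A E n e x"
  shows "i \<in> {1..n} \<Longrightarrow> e i \<in> carrier E"
    and "i \<in> {1..n} \<Longrightarrow> x i \<in> dual_mod A E"
    and "v \<in> carrier E \<Longrightarrow> (\<Oplus>\<^bsub>E\<^esub>j\<in>{1..n}. x j v \<odot>\<^bsub>E\<^esub> e j) = v"
  using assms unfolding projective_basis_def by auto

lemma projective_basis_imp_fg:
  assumes "projective_basis A E n e x" and "v \<in> carrier E"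
  obtains a where "a \<in> {1..n} \<rightarrow> carrier A" and "v = lin_comb E n e a"
proof
  show "(\<lambda>i. x i v) \<in> {1..n} \<rightarrow> carrier A"
    using dual_modD(1)[OF projective_basisD(2)[OF assms(1)] assms(2)] by blast
  show "v = lin_comb E n e (\<lambda>i. x i v)"
    using projective_basisD(3)[OF assms] by (simp add: lin_comb_def)
qed

lemma mod_hom_finsum:
  assumes E: "module A E" and F: "module A F" and f: "f \<in> mod_hom A E F"
    and "finite I" and "g \<in> I \<rightarrow> carrier E"
  shows "f (finsum E g I) = finsum F (\<lambda>i. f (g i)) I"
proof -
  interpret E: module A E by fact
  interpret F: module A F by fact
  have f_cl: "f u \<in> carrier F" if "u \<in> carrier E" for u
    using f that by (auto simp: mod_hom_def)
  have f_add: "f (u \<oplus>\<^bsub>E\<^esub> v) = f u \<oplus>\<^bsub>F\<^esub> f v" if "u \<in> carrier E" "v \<in> carrier E" for u v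
    using f that by (auto simp: mod_hom_def)
  have "f (\<zero>\<^bsub>A\<^esub> \<odot>\<^bsub>E\<^esub> \<zero>\<^bsub>E\<^esub>) = \<zero>\<^bsub>A\<^esub> \<odot>\<^bsub>F\<^esub> f \<zero>\<^bsub>E\<^esub>"
    using f unfolding mod_hom_def by blast
  then have f_0: "f \<zero>\<^bsub>E\<^esub> = \<zero>\<^bsub>F\<^esub>"
    by (simp add: f_cl)
  show ?thesis
    using assms(4,5)
  proof (induction I rule: finite_induct)
    case empty
    then show ?case by (simp add: f_0)
  next
    case (insert i I)
    then have "g i \<in> carrier E" "g \<in> I \<rightarrow> carrier E" "(\<lambda>i. f (g i)) \<in> I \<rightarrow> carrier F"
      by (auto intro: f_cl)
    with insert show ?case by (simp add: f_add f_cl)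
  qed
qed

lemma projective_basis_imp_projective:
  assumes "module A E" and P: "module A P" and Q: "module A Q"
    and B: "projective_basis A E n e x"
    and g: "g \<in> mod_hom A P Q" "g ` carrier P = carrier Q" and f: "f \<in> mod_hom A E Q"
  shows "\<exists>h\<in>mod_hom A E P. \<forall>v\<in>carrier E. g (h v) = f v"
proof -
  interpret E: module A E by fact
  interpret P: module A P by fact
  interpret Q: module A Q by fact
  note [simp] = projective_basisD(1)[OF B] dual_modD[OF projective_basisD(2)[OF B]]
  have f_cl: "f u \<in> carrier Q" if "u \<in> carrier E" for u
    using f that by (auto simp: mod_hom_def)
  have f_sm: "f (c \<odot>\<^bsub>E\<^esub> v) = c \<odot>\<^bsub>Q\<^esub> f v" if "c \<in> carrier A" "v \<in> carrier E" for c v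
    using f that by (auto simp: mod_hom_def)
  have g_sm: "g (c \<odot>\<^bsub>P\<^esub> v) = c \<odot>\<^bsub>Q\<^esub> g v" if "c \<in> carrier A" "v \<in> carrier P" for c v
    using g that by (auto simp: mod_hom_def)
  have "\<exists>p. p \<in> carrier P \<and> g p = f (e i)" if "i \<in> {1..n}" for i
    using f_cl[OF projective_basisD(1)[OF B that]] g(2) by (metis imageE)
  then obtain p where p: "\<And>i. i \<in> {1..n} \<Longrightarrow> p i \<in> carrier P \<and> g (p i) = f (e i)"
    by metis
  define h where "h v = (\<Oplus>\<^bsub>P\<^esub>i\<in>{1..n}. x i v \<odot>\<^bsub>P\<^esub> p i)" for v
  have "h v \<in> carrier P" if "v \<in> carrier E" for v
    unfolding h_def using p that by (intro P.finsum_closed) auto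
  moreover have "h (u \<oplus>\<^bsub>E\<^esub> v) = h u \<oplus>\<^bsub>P\<^esub> h v" if "u \<in> carrier E" "v \<in> carrier E" for u v
  proof -
    have "h (u \<oplus>\<^bsub>E\<^esub> v) = (\<Oplus>\<^bsub>P\<^esub>i\<in>{1..n}. x i u \<odot>\<^bsub>P\<^esub> p i \<oplus>\<^bsub>P\<^esub> x i v \<odot>\<^bsub>P\<^esub> p i)"
      unfolding h_def using p that by (intro P.finsum_cong') (auto simp: P.smult_l_distr)
    also have "\<dots> = h u \<oplus>\<^bsub>P\<^esub> h v"
      unfolding h_def using p that by (intro P.finsum_addf) auto
    finally show ?thesis .
  qed
  moreover have "h (c \<odot>\<^bsub>E\<^esub> v) = c \<odot>\<^bsub>P\<^esub> h v" if "c \<in> carrier A" "v \<in> carrier E" for c v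
  proof -
    have "h (c \<odot>\<^bsub>E\<^esub> v) = (\<Oplus>\<^bsub>P\<^esub>i\<in>{1..n}. c \<odot>\<^bsub>P\<^esub> (x i v \<odot>\<^bsub>P\<^esub> p i))"
      unfolding h_def using p that by (intro P.finsum_cong') (auto simp: P.smult_assoc1)
    also have "\<dots> = c \<odot>\<^bsub>P\<^esub> h v"
      unfolding h_def using p that by (intro P.finsum_smult_ldistr[symmetric]) auto
    finally show ?thesis .
  qed
  ultimately have "h \<in> mod_hom A E P"
    by (auto simp: mod_hom_def)
  moreover have "g (h v) = f v" if v: "v \<in> carrier E" for v
  proof -
    have "g (h v) = (\<Oplus>\<^bsub>Q\<^esub>i\<in>{1..n}. g (x i v \<odot>\<^bsub>P\<^esub> p i))"
      unfolding h_def using p v by (intro mod_hom_finsum[OF P Q g(1)]) auto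
    also have "\<dots> = (\<Oplus>\<^bsub>Q\<^esub>i\<in>{1..n}. f (x i v \<odot>\<^bsub>E\<^esub> e i))"
      using p v by (intro Q.finsum_cong') (auto simp: g_sm f_sm f_cl)
    also have "\<dots> = f (\<Oplus>\<^bsub>E\<^esub>i\<in>{1..n}. x i v \<odot>\<^bsub>E\<^esub> e i)"
      using v by (intro mod_hom_finsum[OF assms(1) Q f, symmetric]) auto
    finally show ?thesis
      using projective_basisD(3)[OF B v] by simp
  qed
  ultimately show ?thesis by blast
qed

lemma der_bracket_in_Der:
  assumes A: "cring A" and K: "subring K A" and d: "\<delta> \<in> Der K A" and h: "\<eta> \<in> Der K A"
  shows "der_bracket A \<delta> \<eta> \<in> Der K A"
proof -
  interpret cring A by fact
  note [simp] = DerD(1,2,4)[OF d] DerD(1,2,4)[OF h]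
  have K_cl: "c \<in> carrier A" if "c \<in> K" for c
    using subringE(1)[OF K] that by auto
  have "der_bracket A \<delta> \<eta> (a \<oplus>\<^bsub>A\<^esub> b) = der_bracket A \<delta> \<eta> a \<oplus>\<^bsub>A\<^esub> der_bracket A \<delta> \<eta> b"
    if "a \<in> carrier A" "b \<in> carrier A" for a b
  proof -
    have *: "(p \<oplus>\<^bsub>A\<^esub> q) \<ominus>\<^bsub>A\<^esub> (r \<oplus>\<^bsub>A\<^esub> s) = (p \<ominus>\<^bsub>A\<^esub> r) \<oplus>\<^bsub>A\<^esub> (q \<ominus>\<^bsub>A\<^esub> s)"
      if "p \<in> carrier A" "q \<in> carrier A" "r \<in> carrier A" "s \<in> carrier A" for p q r s
      using that by algebra
    show ?thesis using that by (simp add: der_bracket_def *)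
  qed
  moreover have "der_bracket A \<delta> \<eta> (c \<otimes>\<^bsub>A\<^esub> a) = c \<otimes>\<^bsub>A\<^esub> der_bracket A \<delta> \<eta> a"
    if "c \<in> K" "a \<in> carrier A" for c a
  proof -
    have *: "(c \<otimes>\<^bsub>A\<^esub> q) \<ominus>\<^bsub>A\<^esub> (c \<otimes>\<^bsub>A\<^esub> r) = c \<otimes>\<^bsub>A\<^esub> (q \<ominus>\<^bsub>A\<^esub> r)"
      if "c \<in> carrier A" "q \<in> carrier A" "r \<in> carrier A" for c q r
      using that by algebra
    show ?thesis using that K_cl
      by (simp add: der_bracket_def DerD(3)[OF d] DerD(3)[OF h] * del: DerD(4)[OF d] DerD(4)[OF h])
  qed
  moreover have "der_bracket A \<delta> \<eta> (a \<otimes>\<^bsub>A\<^esub> b) =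
      der_bracket A \<delta> \<eta> a \<otimes>\<^bsub>A\<^esub> b \<oplus>\<^bsub>A\<^esub> a \<otimes>\<^bsub>A\<^esub> der_bracket A \<delta> \<eta> b"
    if "a \<in> carrier A" "b \<in> carrier A" for a b
  proof -
    have *: "((a1 \<otimes>\<^bsub>A\<^esub> b \<oplus>\<^bsub>A\<^esub> ah \<otimes>\<^bsub>A\<^esub> bd) \<oplus>\<^bsub>A\<^esub> (ad \<otimes>\<^bsub>A\<^esub> bh \<oplus>\<^bsub>A\<^esub> a \<otimes>\<^bsub>A\<^esub> b1))
        \<ominus>\<^bsub>A\<^esub> ((a2 \<otimes>\<^bsub>A\<^esub> b \<oplus>\<^bsub>A\<^esub> ad \<otimes>\<^bsub>A\<^esub> bh) \<oplus>\<^bsub>A\<^esub> (ah \<otimes>\<^bsub>A\<^esub> bd \<oplus>\<^bsub>A\<^esub> a \<otimes>\<^bsub>A\<^esub> b2))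
        = (a1 \<ominus>\<^bsub>A\<^esub> a2) \<otimes>\<^bsub>A\<^esub> b \<oplus>\<^bsub>A\<^esub> a \<otimes>\<^bsub>A\<^esub> (b1 \<ominus>\<^bsub>A\<^esub> b2)"
      if "a1 \<in> carrier A" "a2 \<in> carrier A" "ad \<in> carrier A" "ah \<in> carrier A" "a \<in> carrier A"
        "b1 \<in> carrier A" "b2 \<in> carrier A" "bd \<in> carrier A" "bh \<in> carrier A" "b \<in> carrier A"
      for a1 a2 ad ah a b1 b2 bd bh b
      using that by algebra
    show ?thesis using that by (simp add: der_bracket_def *)
  qed
  ultimately show ?thesis
    by (auto simp: Der_def) (simp add: der_bracket_def)
qed

text \<open>\<open>basis_connection\<close> maps into \<open>End\<^sub>K(E)\<close> and satisfies the Leibniz rule of a connection.\<close>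

lemma basis_connection_in_End:
  assumes E: "module A E" and K: "subring K A" and B: "projective_basis A E n e x"
    and d: "\<delta> \<in> Der K A"
  shows "basis_connection E n e x \<delta> \<in> End_mod K E"
proof -
  interpret module A E by fact
  note [simp] = projective_basisD(1)[OF B] dual_modD[OF projective_basisD(2)[OF B]] DerD(1,2)[OF d]
  let ?D = "basis_connection E n e x \<delta>"
  have K_cl: "c \<in> carrier A" if "c \<in> K" for c
    using subringE(1)[OF K] that by auto
  have "?D v \<in> carrier E" if "v \<in> carrier E" for v
    unfolding basis_connection_def using that by (intro M.finsum_closed) auto
  moreover have "?D (u \<oplus>\<^bsub>E\<^esub> v) = ?D u \<oplus>\<^bsub>E\<^esub> ?D v" if "u \<in> carrier E" "v \<in> carrier E" for u v
  proof -
    have "?D (u \<oplus>\<^bsub>E\<^esub> v) =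
        (\<Oplus>\<^bsub>E\<^esub>i\<in>{1..n}. \<delta> (x i u) \<odot>\<^bsub>E\<^esub> e i \<oplus>\<^bsub>E\<^esub> \<delta> (x i v) \<odot>\<^bsub>E\<^esub> e i)"
      unfolding basis_connection_def using that
      by (intro M.finsum_cong') (auto simp: smult_l_distr)
    also have "\<dots> = ?D u \<oplus>\<^bsub>E\<^esub> ?D v"
      unfolding basis_connection_def using that by (intro M.finsum_addf) auto
    finally show ?thesis .
  qed
  moreover have "?D (c \<odot>\<^bsub>E\<^esub> v) = c \<odot>\<^bsub>E\<^esub> ?D v" if "c \<in> K" "v \<in> carrier E" for c v
  proof -
    have "?D (c \<odot>\<^bsub>E\<^esub> v) = (\<Oplus>\<^bsub>E\<^esub>i\<in>{1..n}. c \<odot>\<^bsub>E\<^esub> (\<delta> (x i v) \<odot>\<^bsub>E\<^esub> e i))"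
      unfolding basis_connection_def using that K_cl
      by (intro M.finsum_cong') (auto simp: smult_assoc1 DerD(3)[OF d])
    also have "\<dots> = c \<odot>\<^bsub>E\<^esub> ?D v"
      unfolding basis_connection_def using that K_cl
      by (intro finsum_smult_ldistr[symmetric]) auto
    finally show ?thesis .
  qed
  ultimately show ?thesis by (auto simp: End_mod_def)
qed

lemma basis_connection_Leibniz:
  assumes E: "module A E" and B: "projective_basis A E n e x"
    and d: "\<delta> \<in> Der K A" and a: "a \<in> carrier A" and v: "v \<in> carrier E"
  shows "basis_connection E n e x \<delta> (a \<odot>\<^bsub>E\<^esub> v) =
           \<delta> a \<odot>\<^bsub>E\<^esub> v \<oplus>\<^bsub>E\<^esub> a \<odot>\<^bsub>E\<^esub> basis_connection E n e x \<delta> v"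
proof -
  interpret module A E by fact
  note [simp] = projective_basisD(1)[OF B] dual_modD[OF projective_basisD(2)[OF B]] DerD(1)[OF d]
  have "basis_connection E n e x \<delta> (a \<odot>\<^bsub>E\<^esub> v) =
      (\<Oplus>\<^bsub>E\<^esub>i\<in>{1..n}. \<delta> a \<odot>\<^bsub>E\<^esub> (x i v \<odot>\<^bsub>E\<^esub> e i) \<oplus>\<^bsub>E\<^esub> a \<odot>\<^bsub>E\<^esub> (\<delta> (x i v) \<odot>\<^bsub>E\<^esub> e i))"
    unfolding basis_connection_def using a v
    by (intro M.finsum_cong') (auto simp: smult_l_distr smult_assoc1 DerD(4)[OF d])
  also have "\<dots> = (\<Oplus>\<^bsub>E\<^esub>i\<in>{1..n}. \<delta> a \<odot>\<^bsub>E\<^esub> (x i v \<odot>\<^bsub>E\<^esub> e i)) \<oplus>\<^bsub>E\<^esub>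
      (\<Oplus>\<^bsub>E\<^esub>i\<in>{1..n}. a \<odot>\<^bsub>E\<^esub> (\<delta> (x i v) \<odot>\<^bsub>E\<^esub> e i))"
    using a v by (intro M.finsum_addf) auto
  also have "(\<Oplus>\<^bsub>E\<^esub>i\<in>{1..n}. \<delta> a \<odot>\<^bsub>E\<^esub> (x i v \<odot>\<^bsub>E\<^esub> e i)) =
      \<delta> a \<odot>\<^bsub>E\<^esub> (\<Oplus>\<^bsub>E\<^esub>i\<in>{1..n}. x i v \<odot>\<^bsub>E\<^esub> e i)"
    using a v by (intro finsum_smult_ldistr[symmetric]) auto
  also have "(\<Oplus>\<^bsub>E\<^esub>i\<in>{1..n}. x i v \<odot>\<^bsub>E\<^esub> e i) = v"
    by (rule projective_basisD(3)[OF B v])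
  also have "(\<Oplus>\<^bsub>E\<^esub>i\<in>{1..n}. a \<odot>\<^bsub>E\<^esub> (\<delta> (x i v) \<odot>\<^bsub>E\<^esub> e i)) =
      a \<odot>\<^bsub>E\<^esub> basis_connection E n e x \<delta> v"
    unfolding basis_connection_def using a v by (intro finsum_smult_ldistr[symmetric]) auto
  finally show ?thesis .
qed

end

theory Submission
  imports Defs
begin

text \<open>
  The curvature of a connection is \<open>A\<close>-linear in its module argument, so both sides are determined
  by the case \<open>v = e\<^sub>j\<close>. There the Leibniz rule applied to
  \<open>\<nabla>(\<eta>)(e\<^sub>j) = \<Sum>\<^sub>i \<eta>(M\<^sub>i\<^sub>j) e\<^sub>i\<close> gives
  \<open>\<nabla>(\<delta>)(\<nabla>(\<eta>)(e\<^sub>j)) = \<Sum>\<^sub>i \<delta>(\<eta>(M\<^sub>i\<^sub>j)) e\<^sub>i + \<Sum>\<^sub>i (\<delta>(M) \<eta>(M))\<^sub>i\<^sub>j e\<^sub>i\<close>; the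
  second-order terms cancel against \<open>\<nabla>([\<delta>,\<eta>])(e\<^sub>j)\<close>, leaving the matrix commutator.
\<close>

section \<open>Finite sums and cancellation in abelian groups\<close>

text \<open>Induction on \<open>I\<close>: inserting an index adds one term to each inner sum, and
  \<open>finsum_addf\<close> splits that row off. Used to turn a matrix acting on a column into a
  combination of the matrix columns.\<close>

lemma (in abelian_monoid) finsum_swap:
  assumes "finite I" and "finite J" and "\<And>i j. i \<in> I \<Longrightarrow> j \<in> J \<Longrightarrow> f i j \<in> carrier G"
  shows "(\<Oplus>i\<in>I. \<Oplus>j\<in>J. f i j) = (\<Oplus>j\<in>J. \<Oplus>i\<in>I. f i j)"
  using assms(1,3)
proof (induction I rule: finite_induct)
  case empty
  then show ?case by simp
next
  case (insert i I)
  have "(\<Oplus>j\<in>J. \<Oplus>i\<in>insert i I. f i j) = (\<Oplus>j\<in>J. f i j \<oplus> (\<Oplus>i\<in>I. f i j))"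
    using insert by (intro finsum_cong') (auto intro!: a_closed finsum_closed)
  also have "\<dots> = (\<Oplus>j\<in>J. f i j) \<oplus> (\<Oplus>j\<in>J. \<Oplus>i\<in>I. f i j)"
    using insert.prems by (intro finsum_addf) (auto intro!: finsum_closed)
  also have "(\<Oplus>j\<in>J. \<Oplus>i\<in>I. f i j) = (\<Oplus>i\<in>I. \<Oplus>j\<in>J. f i j)"
    using insert by simp
  also have "(\<Oplus>j\<in>J. f i j) \<oplus> (\<Oplus>i\<in>I. \<Oplus>j\<in>J. f i j) = (\<Oplus>i\<in>insert i I. \<Oplus>j\<in>J. f i j)"
    using insert by (subst finsum_insert) (auto intro!: finsum_closed)
  finally show ?case by simp
qed

text \<open>Only additivity is assumed because the map of interest, \<nabla>(\<alpha>), is additive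
  and \<open>K\<close>-linear but in general not \<open>A\<close>-linear, so
  \<open>mod_hom_finsum\<close> cannot be applied to it.\<close>

lemma (in abelian_group) additive_finsum:
  assumes cl: "f \<in> carrier G \<rightarrow> carrier G"
    and add: "\<And>u v. u \<in> carrier G \<Longrightarrow> v \<in> carrier G \<Longrightarrow> f (u \<oplus> v) = f u \<oplus> f v"
    and "finite I" and "g \<in> I \<rightarrow> carrier G"
  shows "f (\<Oplus>i\<in>I. g i) = (\<Oplus>i\<in>I. f (g i))"
proof -
  have "f \<zero> \<oplus> f \<zero> = f \<zero>"
    using add[of \<zero> \<zero>] by simp
  then have f_0: "f \<zero> = \<zero>"
    using cl by (metis Pi_mem add.r_cancel_one' zero_closed)
  show ?thesis
    using assms(3,4)
  proof (induction I rule: finite_induct)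
    case empty
    then show ?case by (simp add: f_0)
  next
    case (insert i I)
    then have "g i \<in> carrier G" "f (g i) \<in> carrier G" "g \<in> I \<rightarrow> carrier G"
      "(\<lambda>i. f (g i)) \<in> I \<rightarrow> carrier G"
      using cl by auto
    with insert show ?case by (simp add: add)
  qed
qed

text \<open>This and the next rule carry the cancellations in \<open>E\<close> from which the
  curvature formulas follow.\<close>

lemma (in abelian_group) add_diff_add_left:
  assumes "p \<in> carrier G" "q \<in> carrier G" "r \<in> carrier G"
  shows "(p \<oplus> q) \<ominus> (p \<oplus> r) = q \<ominus> r"
proof -
  \<comment> \<open>Regrouping brings \<open>p\<close> next to its inverse; \<open>r_neg\<close> is
    withheld so that this pair survives until both sides have been put in the same order.\<close>
  have "(p \<oplus> q) \<ominus> (p \<oplus> r) = (q \<oplus> (p \<oplus> \<ominus> p)) \<oplus> \<ominus> r"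
    using assms by (simp add: minus_eq minus_add a_ac del: r_neg)
  then show ?thesis
    using assms by (simp add: minus_eq r_neg)
qed

lemma (in abelian_group) add_diff_add:
  assumes "p \<in> carrier G" "q \<in> carrier G" "r \<in> carrier G" "s \<in> carrier G"
  shows "(p \<oplus> q) \<ominus> (r \<oplus> s) = (p \<ominus> r) \<oplus> (q \<ominus> s)"
  using assms by (simp add: minus_eq minus_add a_ac)

section \<open>Linear combinations and matrices acting on coordinate columns\<close>

context module
begin

lemma smult_l_diff:
  assumes "a \<in> carrier R" "b \<in> carrier R" "v \<in> carrier M"
  shows "(a \<ominus> b) \<odot>\<^bsub>M\<^esub> v = a \<odot>\<^bsub>M\<^esub> v \<ominus>\<^bsub>M\<^esub> b \<odot>\<^bsub>M\<^esub> v"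
  using assms by (simp add: R.minus_eq M.minus_eq smult_l_distr smult_l_minus)

lemma smult_r_diff:
  assumes "a \<in> carrier R" "u \<in> carrier M" "v \<in> carrier M"
  shows "a \<odot>\<^bsub>M\<^esub> (u \<ominus>\<^bsub>M\<^esub> v) = a \<odot>\<^bsub>M\<^esub> u \<ominus>\<^bsub>M\<^esub> a \<odot>\<^bsub>M\<^esub> v"
  using assms by (simp add: M.minus_eq smult_r_distr smult_r_minus)

lemma lin_comb_closed:
  assumes "e \<in> {1..n} \<rightarrow> carrier M" "c \<in> {1..n} \<rightarrow> carrier R"
  shows "lin_comb M n e c \<in> carrier M"
  unfolding lin_comb_def using assms by (intro M.finsum_closed) auto

lemma lin_comb_add:
  assumes "e \<in> {1..n} \<rightarrow> carrier M" "c \<in> {1..n} \<rightarrow> carrier R" "d \<in> {1..n} \<rightarrow> carrier R"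
  shows "lin_comb M n e (\<lambda>i. c i \<oplus> d i) = lin_comb M n e c \<oplus>\<^bsub>M\<^esub> lin_comb M n e d"
proof -
  have "lin_comb M n e (\<lambda>i. c i \<oplus> d i) = (\<Oplus>\<^bsub>M\<^esub>i\<in>{1..n}. c i \<odot>\<^bsub>M\<^esub> e i \<oplus>\<^bsub>M\<^esub> d i \<odot>\<^bsub>M\<^esub> e i)"
    unfolding lin_comb_def using assms
    by (intro M.finsum_cong') (auto simp: smult_l_distr Pi_iff)
  also have "\<dots> = lin_comb M n e c \<oplus>\<^bsub>M\<^esub> lin_comb M n e d"
    unfolding lin_comb_def using assms by (intro M.finsum_addf) auto
  finally show ?thesis .
qed

lemma lin_comb_diff:
  assumes e: "e \<in> {1..n} \<rightarrow> carrier M"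
    and c: "c \<in> {1..n} \<rightarrow> carrier R" and d: "d \<in> {1..n} \<rightarrow> carrier R"
  shows "lin_comb M n e (\<lambda>i. c i \<ominus> d i) = lin_comb M n e c \<ominus>\<^bsub>M\<^esub> lin_comb M n e d"
proof -
  have cd: "(\<lambda>i. c i \<ominus> d i) \<in> {1..n} \<rightarrow> carrier R"
    using c d by auto
  \<comment> \<open>Subtraction is reduced to addition by writing each \<open>c i\<close> as
    \<open>(c i \<ominus> d i) \<oplus> d i\<close>.\<close>
  have "lin_comb M n e c = lin_comb M n e (\<lambda>i. (c i \<ominus> d i) \<oplus> d i)"
    unfolding lin_comb_def using e c d
    by (intro M.finsum_cong') (auto simp: Pi_iff R.minus_eq R.a_assoc R.l_neg)
  also have "\<dots> = lin_comb M n e (\<lambda>i. c i \<ominus> d i) \<oplus>\<^bsub>M\<^esub> lin_comb M n e d"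
    by (rule lin_comb_add[OF e cd d])
  finally show ?thesis
    using lin_comb_closed[OF e cd] lin_comb_closed[OF e d]
    by (simp add: M.minus_eq M.a_assoc M.r_neg)
qed

text \<open>A matrix times a column is the combination of the matrix columns weighted by the entries
  of \<open>c\<close>, so the claim is an exchange of two finite sums. It serves twice: for the
  product of two differentiated matrices, and for the commutator acting on \<open>a\<close>.\<close>

lemma lin_comb_mat_vec:
  assumes e: "e \<in> {1..n} \<rightarrow> carrier M" and c: "c \<in> {1..n} \<rightarrow> carrier R"
    and N: "\<And>i j. i \<in> {1..n} \<Longrightarrow> j \<in> {1..n} \<Longrightarrow> N i j \<in> carrier R"
  shows "lin_comb M n e (mat_vec R n N c) =
    (\<Oplus>\<^bsub>M\<^esub>j\<in>{1..n}. c j \<odot>\<^bsub>M\<^esub> lin_comb M n e (\<lambda>i. N i j))"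
proof -
  have e': "e i \<in> carrier M" and c': "c i \<in> carrier R" if "i \<in> {1..n}" for i
    using e c that by auto
  have sum_smult: "(\<Oplus>j\<in>{1..n}. g j) \<odot>\<^bsub>M\<^esub> u = (\<Oplus>\<^bsub>M\<^esub>j\<in>{1..n}. g j \<odot>\<^bsub>M\<^esub> u)"
    if "u \<in> carrier M" "g \<in> {1..n} \<rightarrow> carrier R" for u g
  proof -
    \<comment> \<open>The induction runs over subsets of \<open>{1..n}\<close>, since
      \<open>g\<close> is known to lie in the carrier only there.\<close>
    have "(\<Oplus>j\<in>J. g j) \<odot>\<^bsub>M\<^esub> u = (\<Oplus>\<^bsub>M\<^esub>j\<in>J. g j \<odot>\<^bsub>M\<^esub> u)"
      if "finite J" "J \<subseteq> {1..n}" for J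
      using that
    proof (induction J rule: finite_induct)
      case empty
      then show ?case using \<open>u \<in> carrier M\<close> by simp
    next
      case (insert j J)
      then have "g j \<in> carrier R" "g \<in> J \<rightarrow> carrier R" "(\<lambda>j. g j \<odot>\<^bsub>M\<^esub> u) \<in> J \<rightarrow> carrier M"
        using \<open>g \<in> _\<close> \<open>u \<in> carrier M\<close> by auto
      with insert \<open>u \<in> carrier M\<close> show ?case
        by (simp add: smult_l_distr)
    qed
    then show ?thesis by simp
  qed
  have "lin_comb M n e (mat_vec R n N c) =
      (\<Oplus>\<^bsub>M\<^esub>i\<in>{1..n}. \<Oplus>\<^bsub>M\<^esub>j\<in>{1..n}. c j \<odot>\<^bsub>M\<^esub> (N i j \<odot>\<^bsub>M\<^esub> e i))"
    unfolding lin_comb_def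
  proof (intro M.finsum_cong' refl)
    show "(\<lambda>i. \<Oplus>\<^bsub>M\<^esub>j\<in>{1..n}. c j \<odot>\<^bsub>M\<^esub> (N i j \<odot>\<^bsub>M\<^esub> e i)) \<in> {1..n} \<rightarrow> carrier M"
      using e' c' N by (auto intro!: M.finsum_closed)
    fix i assume i: "i \<in> {1..n}"
    have "mat_vec R n N c i \<odot>\<^bsub>M\<^esub> e i = (\<Oplus>\<^bsub>M\<^esub>j\<in>{1..n}. (N i j \<otimes> c j) \<odot>\<^bsub>M\<^esub> e i)"
      unfolding mat_vec_def using i e' c' N by (intro sum_smult) auto
    \<comment> \<open>Commutativity of the base ring moves the coordinate \<open>c j\<close> in
      front of the matrix entry.\<close>
    also have "\<dots> = (\<Oplus>\<^bsub>M\<^esub>j\<in>{1..n}. c j \<odot>\<^bsub>M\<^esub> (N i j \<odot>\<^bsub>M\<^esub> e i))"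
      using i e' c' N
      by (intro M.finsum_cong' refl) (auto simp: smult_assoc1[symmetric] R.m_comm)
    finally show "mat_vec R n N c i \<odot>\<^bsub>M\<^esub> e i =
        (\<Oplus>\<^bsub>M\<^esub>j\<in>{1..n}. c j \<odot>\<^bsub>M\<^esub> (N i j \<odot>\<^bsub>M\<^esub> e i))" .
  qed
  also have "\<dots> = (\<Oplus>\<^bsub>M\<^esub>j\<in>{1..n}. \<Oplus>\<^bsub>M\<^esub>i\<in>{1..n}. c j \<odot>\<^bsub>M\<^esub> (N i j \<odot>\<^bsub>M\<^esub> e i))"
    using e' c' N by (intro M.finsum_swap) auto
  also have "\<dots> = (\<Oplus>\<^bsub>M\<^esub>j\<in>{1..n}. c j \<odot>\<^bsub>M\<^esub> lin_comb M n e (\<lambda>i. N i j))"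
    unfolding lin_comb_def using e' c' N
    by (intro M.finsum_cong' refl finsum_smult_ldistr[symmetric])
      (auto intro!: M.finsum_closed smult_closed)
  finally show ?thesis .
qed

end

section \<open>Linearity of the curvature over the base ring\<close>

text \<open>For \<open>v = e j\<close> the coefficients are column \<open>j\<close> of \<delta>(M),
  which is how the fundamental matrix enters.\<close>

lemma basis_connection_eq_lin_comb:
  "basis_connection E n e x \<delta> v = lin_comb E n e (\<lambda>i. \<delta> (x i v))"
  by (simp add: basis_connection_def lin_comb_def)

lemma End_modD:
  assumes "f \<in> End_mod K E"
  shows "f \<in> carrier E \<rightarrow> carrier E"
    and "v \<in> carrier E \<Longrightarrow> f v \<in> carrier E"
    and "u \<in> carrier E \<Longrightarrow> v \<in> carrier E \<Longrightarrow> f (u \<oplus>\<^bsub>E\<^esub> v) = f u \<oplus>\<^bsub>E\<^esub> f v"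
  using assms unfolding End_mod_def by auto

text \<open>Holds for any \<open>D\<close> with values in \<open>End_mod K E\<close> that obeys the
  Leibniz rule: in the commutator the mixed terms \<delta>(a) D(\<eta>)(v) and \<eta>(a)
  D(\<delta>)(v) cancel, and the remaining multiple of \<open>v\<close> is ([\<delta>,\<eta>](a)) v,
  which the bracket term removes.\<close>

lemma curvature_in_mod_hom:
  fixes A (structure) and E (structure)
  assumes E: "module A E" and K: "subring K A"
    and D: "\<And>\<delta>. \<delta> \<in> Der K A \<Longrightarrow> D \<delta> \<in> End_mod K E"
    and Leibniz: "\<And>\<delta> a v. \<delta> \<in> Der K A \<Longrightarrow> a \<in> carrier A \<Longrightarrow> v \<in> carrier E \<Longrightarrow>
      D \<delta> (a \<odot>\<^bsub>E\<^esub> v) = \<delta> a \<odot>\<^bsub>E\<^esub> v \<oplus>\<^bsub>E\<^esub> a \<odot>\<^bsub>E\<^esub> D \<delta> v"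
    and d: "\<delta> \<in> Der K A" and h: "\<eta> \<in> Der K A"
  shows "curvature A E D \<delta> \<eta> \<in> mod_hom A E E"
proof -
  interpret module A E by fact
  let ?b = "der_bracket A \<delta> \<eta>"
  have b: "?b \<in> Der K A"
    by (rule der_bracket_in_Der[OF R.is_cring K d h])
  note cl = End_modD(2)[OF D[OF d]] End_modD(2)[OF D[OF h]] End_modD(2)[OF D[OF b]]
  note ad = End_modD(3)[OF D[OF d]] End_modD(3)[OF D[OF h]] End_modD(3)[OF D[OF b]]
  note dc = DerD(1)[OF d] DerD(1)[OF h]
  have "curvature A E D \<delta> \<eta> (u \<oplus>\<^bsub>E\<^esub> v) = curvature A E D \<delta> \<eta> u \<oplus>\<^bsub>E\<^esub> curvature A E D \<delta> \<eta> v"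
    if "u \<in> carrier E" "v \<in> carrier E" for u v
    using that by (simp add: curvature_def cl ad M.minus_eq M.minus_add M.a_ac)
  moreover have "curvature A E D \<delta> \<eta> (a \<odot>\<^bsub>E\<^esub> v) = a \<odot>\<^bsub>E\<^esub> curvature A E D \<delta> \<eta> v"
    if a: "a \<in> carrier A" and v: "v \<in> carrier E" for a v
  proof -
    \<comment> \<open>Here \<open>p\<close>, \<open>p'\<close> stand for the terms with two
      derivations on \<open>a\<close>, \<open>q\<close> and \<open>r\<close> for the mixed terms,
      and \<open>s\<close>, \<open>s'\<close>, \<open>t\<close> for \<open>a\<close> times the three
      terms of the curvature at \<open>v\<close>.\<close>
    have cancel: "((p \<oplus>\<^bsub>E\<^esub> q) \<oplus>\<^bsub>E\<^esub> (r \<oplus>\<^bsub>E\<^esub> s) \<ominus>\<^bsub>E\<^esub> ((p' \<oplus>\<^bsub>E\<^esub> r) \<oplus>\<^bsub>E\<^esub> (q \<oplus>\<^bsub>E\<^esub> s')))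
        \<ominus>\<^bsub>E\<^esub> ((p \<ominus>\<^bsub>E\<^esub> p') \<oplus>\<^bsub>E\<^esub> t) = (s \<ominus>\<^bsub>E\<^esub> s') \<ominus>\<^bsub>E\<^esub> t"
      if "p \<in> carrier E" "q \<in> carrier E" "r \<in> carrier E" "s \<in> carrier E" "p' \<in> carrier E"
        "s' \<in> carrier E" "t \<in> carrier E" for p q r s p' s' t
    proof -
      have "(p \<oplus>\<^bsub>E\<^esub> q) \<oplus>\<^bsub>E\<^esub> (r \<oplus>\<^bsub>E\<^esub> s) \<ominus>\<^bsub>E\<^esub> ((p' \<oplus>\<^bsub>E\<^esub> r) \<oplus>\<^bsub>E\<^esub> (q \<oplus>\<^bsub>E\<^esub> s')) =
          ((q \<oplus>\<^bsub>E\<^esub> r) \<oplus>\<^bsub>E\<^esub> (p \<oplus>\<^bsub>E\<^esub> s)) \<ominus>\<^bsub>E\<^esub> ((q \<oplus>\<^bsub>E\<^esub> r) \<oplus>\<^bsub>E\<^esub> (p' \<oplus>\<^bsub>E\<^esub> s'))"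
        using that by (simp add: M.a_ac)
      also have "\<dots> = (p \<ominus>\<^bsub>E\<^esub> p') \<oplus>\<^bsub>E\<^esub> (s \<ominus>\<^bsub>E\<^esub> s')"
        using that by (simp add: M.add_diff_add_left M.add_diff_add)
      finally show ?thesis
        using that by (simp add: M.add_diff_add_left)
    qed
    have "D \<delta> (D \<eta> (a \<odot>\<^bsub>E\<^esub> v)) =
        (\<delta> (\<eta> a) \<odot>\<^bsub>E\<^esub> v \<oplus>\<^bsub>E\<^esub> \<eta> a \<odot>\<^bsub>E\<^esub> D \<delta> v) \<oplus>\<^bsub>E\<^esub> (\<delta> a \<odot>\<^bsub>E\<^esub> D \<eta> v \<oplus>\<^bsub>E\<^esub> a \<odot>\<^bsub>E\<^esub> D \<delta> (D \<eta> v))"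
      using a v by (simp add: Leibniz[OF d] Leibniz[OF h] cl ad dc)
    moreover have "D \<eta> (D \<delta> (a \<odot>\<^bsub>E\<^esub> v)) =
        (\<eta> (\<delta> a) \<odot>\<^bsub>E\<^esub> v \<oplus>\<^bsub>E\<^esub> \<delta> a \<odot>\<^bsub>E\<^esub> D \<eta> v) \<oplus>\<^bsub>E\<^esub> (\<eta> a \<odot>\<^bsub>E\<^esub> D \<delta> v \<oplus>\<^bsub>E\<^esub> a \<odot>\<^bsub>E\<^esub> D \<eta> (D \<delta> v))"
      using a v by (simp add: Leibniz[OF d] Leibniz[OF h] cl ad dc)
    moreover have "D ?b (a \<odot>\<^bsub>E\<^esub> v) =
        (\<delta> (\<eta> a) \<odot>\<^bsub>E\<^esub> v \<ominus>\<^bsub>E\<^esub> \<eta> (\<delta> a) \<odot>\<^bsub>E\<^esub> v) \<oplus>\<^bsub>E\<^esub> a \<odot>\<^bsub>E\<^esub> D ?b v"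
      \<comment> \<open>The Leibniz rule is applied while the bracket is still folded; only then is
        it expanded into its two terms.\<close>
      using a v by (simp add: Leibniz[OF b]) (simp add: der_bracket_def smult_l_diff dc)
    ultimately show ?thesis
      using a v by (simp add: curvature_def cl dc cancel smult_r_diff)
  qed
  ultimately show ?thesis
    by (auto simp: mod_hom_def) (simp add: curvature_def cl)
qed

section \<open>Curvature on the generators\<close>

lemma curvature_basis_connection_basis:
  fixes A (structure) and E (structure)
  assumes E: "module A E" and K: "subring K A" and B: "projective_basis A E n e x"
    and d: "\<delta> \<in> Der K A" and h: "\<eta> \<in> Der K A" and j: "j \<in> {1..n}"
  shows "curvature A E (basis_connection E n e x) \<delta> \<eta> (e j) =
    lin_comb E n e (\<lambda>i.
      mat_commutator A n (mat_apply \<delta> (fund_matrix e x)) (mat_apply \<eta> (fund_matrix e x)) i j)"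
proof -
  interpret module A E by fact
  let ?D = "basis_connection E n e x"
  let ?M = "fund_matrix e x"
  note e = projective_basisD(1)[OF B]
  have e': "e \<in> {1..n} \<rightarrow> carrier E"
    using e by auto
  have M_cl: "?M i l \<in> carrier A" if "i \<in> {1..n}" "l \<in> {1..n}" for i l
    unfolding fund_matrix_def
    using dual_modD(1)[OF projective_basisD(2)[OF B that(1)] e[OF that(2)]] .
  \<comment> \<open>Stated for arbitrary derivations so that it covers both orders of
    composition.\<close>
  have second: "?D \<alpha> (?D \<beta> (e j)) = lin_comb E n e (\<lambda>i. \<alpha> (\<beta> (?M i j))) \<oplus>\<^bsub>E\<^esub>
      lin_comb E n e (\<lambda>i. mat_mult A n (mat_apply \<alpha> ?M) (mat_apply \<beta> ?M) i j)"
    if \<alpha>: "\<alpha> \<in> Der K A" and \<beta>: "\<beta> \<in> Der K A" for \<alpha> \<beta>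
  proof -
    note D = basis_connection_in_End[OF E K B \<alpha>]
    note cl = e End_modD(2)[OF D] DerD(1)[OF \<alpha>] DerD(1)[OF \<beta>] M_cl
    have "?D \<alpha> (?D \<beta> (e j)) = (\<Oplus>\<^bsub>E\<^esub>i\<in>{1..n}. ?D \<alpha> (\<beta> (?M i j) \<odot>\<^bsub>E\<^esub> e i))"
      unfolding basis_connection_def[of E n e x \<beta>] fund_matrix_def[symmetric]
      using j cl by (subst M.additive_finsum[OF End_modD(1,3)[OF D]]) (auto simp: fund_matrix_def)
    also have "\<dots> = (\<Oplus>\<^bsub>E\<^esub>i\<in>{1..n}. \<alpha> (\<beta> (?M i j)) \<odot>\<^bsub>E\<^esub> e i \<oplus>\<^bsub>E\<^esub> \<beta> (?M i j) \<odot>\<^bsub>E\<^esub> ?D \<alpha> (e i))"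
      using j cl
      by (intro M.finsum_cong' refl basis_connection_Leibniz[OF E B \<alpha>]) auto
    also have "\<dots> = lin_comb E n e (\<lambda>i. \<alpha> (\<beta> (?M i j))) \<oplus>\<^bsub>E\<^esub>
        (\<Oplus>\<^bsub>E\<^esub>i\<in>{1..n}. \<beta> (?M i j) \<odot>\<^bsub>E\<^esub> ?D \<alpha> (e i))"
      unfolding lin_comb_def using j cl by (intro M.finsum_addf) auto
    \<comment> \<open>The element \<nabla>(\<alpha>)(e_i) has column \<open>i\<close> of \<alpha>(M)
      as coefficients, so the sum is \<alpha>(M) applied to column \<open>j\<close> of \<beta>(M),
      that is, column \<open>j\<close> of the product.\<close>
    also have "(\<Oplus>\<^bsub>E\<^esub>i\<in>{1..n}. \<beta> (?M i j) \<odot>\<^bsub>E\<^esub> ?D \<alpha> (e i)) =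
        lin_comb E n e (mat_vec A n (mat_apply \<alpha> ?M) (\<lambda>l. \<beta> (?M l j)))"
      using j cl
      by (subst lin_comb_mat_vec)
        (auto simp: mat_apply_def basis_connection_eq_lin_comb fund_matrix_def)
    also have "mat_vec A n (mat_apply \<alpha> ?M) (\<lambda>l. \<beta> (?M l j)) =
        (\<lambda>i. mat_mult A n (mat_apply \<alpha> ?M) (mat_apply \<beta> ?M) i j)"
      by (simp add: mat_vec_def mat_mult_def mat_apply_def)
    finally show ?thesis .
  qed
  have cl2: "(\<lambda>i. \<alpha> (\<beta> (?M i j))) \<in> {1..n} \<rightarrow> carrier A"
      "(\<lambda>i. mat_mult A n (mat_apply \<alpha> ?M) (mat_apply \<beta> ?M) i j) \<in> {1..n} \<rightarrow> carrier A"
    if \<alpha>: "\<alpha> \<in> Der K A" and \<beta>: "\<beta> \<in> Der K A" for \<alpha> \<beta>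
    using j M_cl DerD(1)[OF \<alpha>] DerD(1)[OF \<beta>]
    by (auto simp: mat_mult_def mat_apply_def intro!: R.finsum_closed)
  have bracket: "?D (der_bracket A \<delta> \<eta>) (e j) =
      lin_comb E n e (\<lambda>i. \<delta> (\<eta> (?M i j))) \<ominus>\<^bsub>E\<^esub> lin_comb E n e (\<lambda>i. \<eta> (\<delta> (?M i j)))"
    unfolding lin_comb_diff[OF e' cl2(1)[OF d h] cl2(1)[OF h d], symmetric]
    by (simp add: basis_connection_eq_lin_comb der_bracket_def fund_matrix_def)
  \<comment> \<open>The second-order parts are \<open>p\<close> and \<open>p'\<close>, the
    matrix-product parts \<open>q\<close> and \<open>q'\<close>.\<close>
  have cancel: "((p \<oplus>\<^bsub>E\<^esub> q) \<ominus>\<^bsub>E\<^esub> (p' \<oplus>\<^bsub>E\<^esub> q')) \<ominus>\<^bsub>E\<^esub> (p \<ominus>\<^bsub>E\<^esub> p') = q \<ominus>\<^bsub>E\<^esub> q'"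
    if "p \<in> carrier E" "q \<in> carrier E" "p' \<in> carrier E" "q' \<in> carrier E" for p q p' q'
  proof -
    have "(p \<oplus>\<^bsub>E\<^esub> q) \<ominus>\<^bsub>E\<^esub> (p' \<oplus>\<^bsub>E\<^esub> q') = (p \<ominus>\<^bsub>E\<^esub> p') \<oplus>\<^bsub>E\<^esub> (q \<ominus>\<^bsub>E\<^esub> q')"
      using that by (simp add: M.add_diff_add)
    \<comment> \<open>The added zero gives both sides the common summand
      \<open>p \<ominus> p'\<close> in the shape \<open>add_diff_add_left\<close> expects.\<close>
    moreover have "\<dots> \<ominus>\<^bsub>E\<^esub> ((p \<ominus>\<^bsub>E\<^esub> p') \<oplus>\<^bsub>E\<^esub> \<zero>\<^bsub>E\<^esub>) = (q \<ominus>\<^bsub>E\<^esub> q') \<ominus>\<^bsub>E\<^esub> \<zero>\<^bsub>E\<^esub>"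
      using that by (intro M.add_diff_add_left) auto
    ultimately show ?thesis
      using that by (simp add: M.minus_eq)
  qed
  show ?thesis
    unfolding curvature_def second[OF d h] second[OF h d] bracket mat_commutator_def
      lin_comb_diff[OF e' cl2(2)[OF d h] cl2(2)[OF h d]]
    by (intro cancel lin_comb_closed e' cl2 d h)
qed

section \<open>From generators to arbitrary coordinate columns\<close>

theorem theorem3p2:
  fixes A :: "('a, 'r) ring_scheme" and E :: "('a, 'b, 'm) module_scheme" and K :: "'a set"
    and n :: nat and e :: "nat \<Rightarrow> 'b" and x :: "nat \<Rightarrow> 'b \<Rightarrow> 'a"
    and \<delta> \<eta> :: "'a \<Rightarrow> 'a" and v :: 'b and a :: "nat \<Rightarrow> 'a"
  assumes "cring A" and "subring K A" and "module A E"
    and "projective_basis A E n e x"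
    and "\<delta> \<in> Der K A" and "\<eta> \<in> Der K A"
    and "a \<in> {1..n} \<rightarrow> carrier A" and "v \<in> carrier E" and "v = lin_comb E n e a"
  shows "curvature A E (basis_connection E n e x) \<delta> \<eta> v =
           lin_comb E n e
             (mat_vec A n
               (mat_commutator A n (mat_apply \<delta> (fund_matrix e x)) (mat_apply \<eta> (fund_matrix e x))) a)"
proof -
  note K = assms(2) and E = assms(3) and B = assms(4) and d = assms(5) and h = assms(6)
    and a = assms(7)
  interpret module A E by fact
  let ?R = "curvature A E (basis_connection E n e x) \<delta> \<eta>"
  let ?C = "mat_commutator A n (mat_apply \<delta> (fund_matrix e x)) (mat_apply \<eta> (fund_matrix e x))"
  note e = projective_basisD(1)[OF B]
  have hom: "?R \<in> mod_hom A E E"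
    by (intro curvature_in_mod_hom[OF E K] basis_connection_in_End[OF E K B]
        basis_connection_Leibniz[OF E B] d h)
  have C: "?C i j \<in> carrier A" if "i \<in> {1..n}" "j \<in> {1..n}" for i j
    using that e dual_modD(1)[OF projective_basisD(2)[OF B]] DerD(1)[OF d] DerD(1)[OF h]
    by (auto simp: mat_commutator_def mat_mult_def mat_apply_def fund_matrix_def
        intro!: R.minus_closed R.finsum_closed)
  \<comment> \<open>The given column \<open>a\<close> is expanded rather than the canonical
    coordinates x_j(v); by linearity the formula thus holds for every choice of coordinates of
    \<open>v\<close>.\<close>
  have "?R v = (\<Oplus>\<^bsub>E\<^esub>j\<in>{1..n}. ?R (a j \<odot>\<^bsub>E\<^esub> e j))"
    unfolding assms(9) lin_comb_def using a e by (intro mod_hom_finsum[OF E E hom]) auto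
  also have "\<dots> = (\<Oplus>\<^bsub>E\<^esub>j\<in>{1..n}. a j \<odot>\<^bsub>E\<^esub> lin_comb E n e (\<lambda>i. ?C i j))"
  proof (intro M.finsum_cong' refl)
    show "(\<lambda>j. a j \<odot>\<^bsub>E\<^esub> lin_comb E n e (\<lambda>i. ?C i j)) \<in> {1..n} \<rightarrow> carrier E"
      using a e C by (auto intro!: smult_closed lin_comb_closed)
    fix j assume j: "j \<in> {1..n}"
    have "?R (a j \<odot>\<^bsub>E\<^esub> e j) = a j \<odot>\<^bsub>E\<^esub> ?R (e j)"
      using hom Pi_mem[OF a j] e[OF j] by (auto simp: mod_hom_def)
    then show "?R (a j \<odot>\<^bsub>E\<^esub> e j) = a j \<odot>\<^bsub>E\<^esub> lin_comb E n e (\<lambda>i. ?C i j)"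
      by (simp only: curvature_basis_connection_basis[OF E K B d h j])
  qed
  \<comment> \<open>Read backwards, the matrix-column lemma reassembles the values on the generators
    into the commutator acting on \<open>a\<close>.\<close>
  also have "\<dots> = lin_comb E n e (mat_vec A n ?C a)"
    using a e C by (intro lin_comb_mat_vec[symmetric]) auto
  finally show ?thesis .
qed

end
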